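(* Let $\Delta:\tilde{\mathcal D}\to\mathbb R^{n_c}$ be a dynamic safety margin (DSM). Then $\Delta$ is a control barrier function with respect to the augmented system $$\begin{bmatrix}\dot{\bm x}\\ \dot{\bm v}\end{bmatrix}=\begin{bmatrix} f(\bm x)+g(\bm x)\bm u\\ \bm w\end{bmatrix},\qquad (\bm u,\bm w)\in\mathcal U\times\mathbb R^l .$$ That is, there exists a class $\mathscr K$ function $\alpha$ such that for every $(\bm x,\bm v)\in\tilde{\mathcal C}$ there exists $(\bm u,\bm w)\in\mathcal U\times\mathbb R^l$ with $$\min_{i\in\{1,\dots,n_c\}}\Big[\dot\Delta_i(\bm x,\bm v,\bm u,\bm w)+\alpha\big(\Delta_i(\bm x,\bm v)\big)\Big]\ge 0 .$$
   Context: Class $\mathscr K$: continuous strictly increasing $\alpha:[0,\infty)\to[0,\infty)$ with $\alpha(0)=0$. System: $\dot{\bm x}=f(\bm x)+g(\bm x)\bm u$, with $f:\mathbb R^n\to\mathbb R^n$ and $g:\mathbb R^n\to\mathbb R^{n\times m}$ locally Lipschitz, subject to $\bm x\in\mathcal X$, $\bm u\in\mathcal U$, where $\mathcal X\subset\mathbb R^n$ and $\mathcal U\subset\mathbb R^m$ are closed. Equilibria: there is a simply connected manifold of stabilizable equilibria parameterized by continuous $\bar x:\mathbb R^l\to\mathbb R^n$, $\bar u:\mathbb R^l\to\mathbb R^m$ with $f(\bar x(\bm v))+g(\bar x(\bm v))\bar u(\bm v)=0$ for all $\bm v\in\mathbb R^l$. The set of steady-state admissible references $\mathcal V=\{\bm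 v\in\mathbb R^l\mid \bar x(\bm v)\in\mathcal X,\ \bar u(\bm v)\in\mathcal U\}$ is assumed nonempty. Prestabilizing controller: $\pi:\mathbb R^n\times\mathbb R^l\to\mathbb R^m$ is jointly continuous and locally Lipschitz in its first argument, $\pi(\bar x(\bm v),\bm v)=\bar u(\bm v)$, and for each fixed $\bm v$ the point $\bar x(\bm v)$ is an asymptotically stable equilibrium of $\dot{\bm x}=f_\pi(\bm x,\bm v):=f(\bm x)+g(\bm x)\pi(\bm x,\bm v)$. For each $\bm v$, $\mathcal D_{\bm v}\subset\mathbb R^n$ is an open set containing $\bar x(\bm v)$ such that solutions of $\dot{\bm x}=f_\pi(\bm x,\bm v)$ starting in $\mathcal D_{\bm v}$ converge to $\bar x(\bm v)$. The set $\tilde{\mathcal D}=\{(\bm x,\bm v)\in\mathbb R^n\times\mathbb R^l\mid \bm x\in\mathcal D_{\bm v}\}$ is assumed open in $\mathbb R^n\times\mathbb R^l$. Constraint sets: $\mathcal X_{\bm v}=\{\bm x\in\mathcal X\mid \pi(\bm x,\bm v)\in\mathcal U\}$ and $\tilde{\mathcal X}=\{(\bm x,\bm v)\in\mathbb R^n\times\mathbb R^l\mid \bm x\in\mathcal X_{\bm v},\ \bm v\in\mathcal V\}$. DSM: a continuously differentiable $\Delta:\tilde{\mathcal D}\to\mathbb R^{n_c}$ with components $\Delta_i$ is a dynamic safety margin if, with $\tilde{\mathcal C}=\{(\bm x,\bm v)\in\tilde{\mathcal D}\mid \Delta(\bm x,\bm v)\ge 0\}$ (componentwise inequality): (i) $\tilde{\mathcal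 C}\subset\tilde{\mathcal X}$; (ii) $\tilde{\mathcal C}$ is compact in $\mathbb R^n\times\mathbb R^l$; (iii) for every $i\in\{1,\dots,n_c\}$ and $(\bm x,\bm v)\in\tilde{\mathcal D}$, $\Delta_i(\bm x,\bm v)=0$ implies $\frac{\partial\Delta_i}{\partial\bm x}(\bm x,\bm v)f_\pi(\bm x,\bm v)\ge 0$. Notation: $\dot\Delta_i(\bm x,\bm v,\bm u,\bm w)=\frac{\partial\Delta_i}{\partial\bm x}(\bm x,\bm v)\big(f(\bm x)+g(\bm x)\bm u\big)+\frac{\partial\Delta_i}{\partial\bm v}(\bm x,\bm v)\bm w$. *)

theory Defs
  imports "HOL-Analysis.Analysis"
begin

definition locally_lipschitz :: "('a::metric_space \<Rightarrow> 'b::metric_space) \<Rightarrow> bool" where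
  "locally_lipschitz h \<longleftrightarrow> (\<forall>x. \<exists>e>0. \<exists>L. L-lipschitz_on (cball x e) h)"

text \<open>Only used for open \<open>S\<close>; nothing is required of \<open>h\<close> outside \<open>S\<close>.\<close>

definition continuously_differentiable_on ::
    "('a::real_normed_vector \<Rightarrow> 'b::real_normed_vector) \<Rightarrow> 'a set \<Rightarrow> bool" where
  "continuously_differentiable_on h S \<longleftrightarrow>
     (\<exists>h' :: 'a \<Rightarrow> 'a \<Rightarrow>\<^sub>L 'b.
        (\<forall>z\<in>S. (h has_derivative blinfun_apply (h' z)) (at z)) \<and> continuous_on S h')"

text \<open>A class-\<open>K\<close> function is represented by a total function on the reals, of which only the
  restriction to \<open>[0,\<infinity>)\<close> matters.\<close>

definition class_K :: "(real \<Rightarrow> real) \<Rightarrow> bool" where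
  "class_K \<alpha> \<longleftrightarrow> continuous_on {0..} \<alpha> \<and> strict_mono_on {0..} \<alpha> \<and> \<alpha> 0 = 0 \<and> \<alpha> ` {0..} \<subseteq> {0..}"

definition forward_solution ::
    "('a::real_normed_vector \<Rightarrow> 'a) \<Rightarrow> 'a \<Rightarrow> (real \<Rightarrow> 'a) \<Rightarrow> bool" where
  "forward_solution F x0 \<phi> \<longleftrightarrow>
     \<phi> 0 = x0 \<and> (\<forall>t\<ge>0. (\<phi> has_vector_derivative F (\<phi> t)) (at t within {0..}))"

text \<open>The existence part in the next two definitions excludes finite escape times, for which the
  statement about all solutions on \<open>[0,\<infinity>)\<close> would be vacuous.\<close>

definition solutions_converge ::
    "('a::real_normed_vector \<Rightarrow> 'a) \<Rightarrow> 'a \<Rightarrow> 'a \<Rightarrow> bool" where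
  "solutions_converge F x0 xe \<longleftrightarrow>
     (\<exists>\<phi>. forward_solution F x0 \<phi>) \<and>
     (\<forall>\<phi>. forward_solution F x0 \<phi> \<longrightarrow> (\<phi> \<longlongrightarrow> xe) at_top)"

definition lyapunov_stable :: "('a::real_normed_vector \<Rightarrow> 'a) \<Rightarrow> 'a \<Rightarrow> bool" where
  "lyapunov_stable F xe \<longleftrightarrow>
     (\<forall>\<epsilon>>0. \<exists>\<delta>>0. \<forall>x0\<in>ball xe \<delta>.
        (\<exists>\<phi>. forward_solution F x0 \<phi>) \<and>
        (\<forall>\<phi>. forward_solution F x0 \<phi> \<longrightarrow> (\<forall>t\<ge>0. \<phi> t \<in> ball xe \<epsilon>)))"

definition asymptotically_stable_equilibrium ::
    "('a::real_normed_vector \<Rightarrow> 'a) \<Rightarrow> 'a \<Rightarrow> bool" where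
  "asymptotically_stable_equilibrium F xe \<longleftrightarrow>
     F xe = 0 \<and> lyapunov_stable F xe \<and> (\<exists>\<eta>>0. \<forall>x0\<in>ball xe \<eta>. solutions_converge F x0 xe)"

definition stabilizable_equilibrium ::
    "(real^'n \<Rightarrow> real^'n) \<Rightarrow> (real^'n \<Rightarrow> real^'m^'n) \<Rightarrow> real^'n \<Rightarrow> real^'m \<Rightarrow> bool" where
  "stabilizable_equilibrium f g xe ue \<longleftrightarrow>
     f xe + g xe *v ue = 0 \<and>
     (\<exists>\<kappa>. locally_lipschitz \<kappa> \<and> \<kappa> xe = ue \<and>
          asymptotically_stable_equilibrium (\<lambda>x. f x + g x *v \<kappa> x) xe)"

text \<open>Topological manifolds without boundary. Subsets of a Euclidean space are Hausdorff and second
  countable, so only local Euclideanness has to be required.\<close>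

definition topological_manifold :: "nat \<Rightarrow> 'a::euclidean_space set \<Rightarrow> bool" where
  "topological_manifold k M \<longleftrightarrow>
     (\<forall>p\<in>M. \<exists>N W. openin (top_of_set M) N \<and> p \<in> N \<and> openin (Euclidean_space k) W \<and>
        top_of_set N homeomorphic_space subtopology (Euclidean_space k) W)"

text \<open>An equilibrium of the controlled system is a pair of a state and an input, so the manifold
  parameterized by \<open>xbar\<close> and \<open>ubar\<close> is a set of such pairs.\<close>

definition equilibrium_manifold ::
    "(real^'n \<Rightarrow> real^'n) \<Rightarrow> (real^'n \<Rightarrow> real^'m^'n) \<Rightarrow>
     (real^'l \<Rightarrow> real^'n) \<Rightarrow> (real^'l \<Rightarrow> real^'m) \<Rightarrow> bool" where
  "equilibrium_manifold f g xbar ubar \<longleftrightarrow>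
     continuous_on UNIV xbar \<and> continuous_on UNIV ubar \<and>
     (\<forall>v. f (xbar v) + g (xbar v) *v ubar v = 0) \<and>
     (\<forall>v. stabilizable_equilibrium f g (xbar v) (ubar v)) \<and>
     (\<exists>k. topological_manifold k (range (\<lambda>v. (xbar v, ubar v)))) \<and>
     simply_connected (range (\<lambda>v. (xbar v, ubar v)))"

definition admissible_references ::
    "(real^'n) set \<Rightarrow> (real^'m) set \<Rightarrow> (real^'l \<Rightarrow> real^'n) \<Rightarrow> (real^'l \<Rightarrow> real^'m) \<Rightarrow> (real^'l) set" where
  "admissible_references X U xbar ubar = {v. xbar v \<in> X \<and> ubar v \<in> U}"

definition closed_loop ::
    "(real^'n \<Rightarrow> real^'n) \<Rightarrow> (real^'n \<Rightarrow> real^'m^'n) \<Rightarrow> (real^'n \<Rightarrow> real^'l \<Rightarrow> real^'m) \<Rightarrow>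
     real^'n \<Rightarrow> real^'l \<Rightarrow> real^'n" where
  "closed_loop f g \<pi> x v = f x + g x *v \<pi> x v"

definition prestabilizing ::
    "(real^'n \<Rightarrow> real^'n) \<Rightarrow> (real^'n \<Rightarrow> real^'m^'n) \<Rightarrow>
     (real^'l \<Rightarrow> real^'n) \<Rightarrow> (real^'l \<Rightarrow> real^'m) \<Rightarrow> (real^'n \<Rightarrow> real^'l \<Rightarrow> real^'m) \<Rightarrow> bool" where
  "prestabilizing f g xbar ubar \<pi> \<longleftrightarrow>
     continuous_on UNIV (\<lambda>(x, v). \<pi> x v) \<and>
     (\<forall>v. locally_lipschitz (\<lambda>x. \<pi> x v)) \<and>
     (\<forall>v. \<pi> (xbar v) v = ubar v) \<and>
     (\<forall>v. asymptotically_stable_equilibrium (\<lambda>x. closed_loop f g \<pi> x v) (xbar v))"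

definition tilde_D :: "(real^'l \<Rightarrow> (real^'n) set) \<Rightarrow> ((real^'n) \<times> (real^'l)) set" where
  "tilde_D D = {(x, v). x \<in> D v}"

definition attraction_domains ::
    "(real^'n \<Rightarrow> real^'n) \<Rightarrow> (real^'n \<Rightarrow> real^'m^'n) \<Rightarrow> (real^'l \<Rightarrow> real^'n) \<Rightarrow>
     (real^'n \<Rightarrow> real^'l \<Rightarrow> real^'m) \<Rightarrow> (real^'l \<Rightarrow> (real^'n) set) \<Rightarrow> bool" where
  "attraction_domains f g xbar \<pi> D \<longleftrightarrow>
     (\<forall>v. open (D v) \<and> xbar v \<in> D v \<and>
          (\<forall>x0\<in>D v. solutions_converge (\<lambda>x. closed_loop f g \<pi> x v) x0 (xbar v))) \<and>
     open (tilde_D D)"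

definition constraint_slice ::
    "(real^'n) set \<Rightarrow> (real^'m) set \<Rightarrow> (real^'n \<Rightarrow> real^'l \<Rightarrow> real^'m) \<Rightarrow> real^'l \<Rightarrow> (real^'n) set" where
  "constraint_slice X U \<pi> v = {x \<in> X. \<pi> x v \<in> U}"

definition tilde_X ::
    "(real^'n) set \<Rightarrow> (real^'m) set \<Rightarrow> (real^'l \<Rightarrow> real^'n) \<Rightarrow> (real^'l \<Rightarrow> real^'m) \<Rightarrow>
     (real^'n \<Rightarrow> real^'l \<Rightarrow> real^'m) \<Rightarrow> ((real^'n) \<times> (real^'l)) set" where
  "tilde_X X U xbar ubar \<pi> =
     {(x, v). x \<in> constraint_slice X U \<pi> v \<and> v \<in> admissible_references X U xbar ubar}"

definition tilde_C ::
    "(real^'l \<Rightarrow> (real^'n) set) \<Rightarrow> ((real^'n) \<times> (real^'l) \<Rightarrow> real^'c) \<Rightarrow> ((real^'n) \<times> (real^'l)) set" where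
  "tilde_C D \<Delta> = {z \<in> tilde_D D. \<forall>i. 0 \<le> \<Delta> z $ i}"

text \<open>The row vectors of partial derivatives of the \<open>i\<close>-th component, applied to a direction.\<close>

definition partial_x ::
    "((real^'n) \<times> (real^'l) \<Rightarrow> real^'c) \<Rightarrow> 'c \<Rightarrow> real^'n \<Rightarrow> real^'l \<Rightarrow> real^'n \<Rightarrow> real" where
  "partial_x \<Delta> i x v = frechet_derivative (\<lambda>y. \<Delta> (y, v) $ i) (at x)"

definition partial_v ::
    "((real^'n) \<times> (real^'l) \<Rightarrow> real^'c) \<Rightarrow> 'c \<Rightarrow> real^'n \<Rightarrow> real^'l \<Rightarrow> real^'l \<Rightarrow> real" where
  "partial_v \<Delta> i x v = frechet_derivative (\<lambda>y. \<Delta> (x, y) $ i) (at v)"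

definition Delta_dot ::
    "(real^'n \<Rightarrow> real^'n) \<Rightarrow> (real^'n \<Rightarrow> real^'m^'n) \<Rightarrow> ((real^'n) \<times> (real^'l) \<Rightarrow> real^'c) \<Rightarrow> 'c \<Rightarrow>
     real^'n \<Rightarrow> real^'l \<Rightarrow> real^'m \<Rightarrow> real^'l \<Rightarrow> real" where
  "Delta_dot f g \<Delta> i x v u w = partial_x \<Delta> i x v (f x + g x *v u) + partial_v \<Delta> i x v w"

definition dynamic_safety_margin ::
    "(real^'n \<Rightarrow> real^'n) \<Rightarrow> (real^'n \<Rightarrow> real^'m^'n) \<Rightarrow> (real^'n) set \<Rightarrow> (real^'m) set \<Rightarrow>
     (real^'l \<Rightarrow> real^'n) \<Rightarrow> (real^'l \<Rightarrow> real^'m) \<Rightarrow> (real^'n \<Rightarrow> real^'l \<Rightarrow> real^'m) \<Rightarrow>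
     (real^'l \<Rightarrow> (real^'n) set) \<Rightarrow> ((real^'n) \<times> (real^'l) \<Rightarrow> real^'c) \<Rightarrow> bool" where
  "dynamic_safety_margin f g X U xbar ubar \<pi> D \<Delta> \<longleftrightarrow>
     continuously_differentiable_on \<Delta> (tilde_D D) \<and>
     tilde_C D \<Delta> \<subseteq> tilde_X X U xbar ubar \<pi> \<and>
     compact (tilde_C D \<Delta>) \<and>
     (\<forall>i. \<forall>(x, v)\<in>tilde_D D. \<Delta> (x, v) $ i = 0 \<longrightarrow>
        0 \<le> partial_x \<Delta> i x v (closed_loop f g \<pi> x v))"

text \<open>Control barrier functions for the augmented system with state \<open>(x, v)\<close>, dynamics
  \<open>(f x + g x *v u, w)\<close> and input \<open>(u, w)\<close> ranging over \<open>U \<times> UNIV\<close>. The minimum is over a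
  finite nonempty index type.\<close>

definition augmented_control_barrier_function ::
    "(real^'n \<Rightarrow> real^'n) \<Rightarrow> (real^'n \<Rightarrow> real^'m^'n) \<Rightarrow> (real^'m) set \<Rightarrow>
     (real^'l \<Rightarrow> (real^'n) set) \<Rightarrow> ((real^'n) \<times> (real^'l) \<Rightarrow> real^'c) \<Rightarrow> bool" where
  "augmented_control_barrier_function f g U D \<Delta> \<longleftrightarrow>
     (\<exists>\<alpha>. class_K \<alpha> \<and>
        (\<forall>(x, v)\<in>tilde_C D \<Delta>. \<exists>(u, w)\<in>U \<times> (UNIV :: (real^'l) set).
           (MIN i. Delta_dot f g \<Delta> i x v u w + \<alpha> (\<Delta> (x, v) $ i)) \<ge> 0))"

end

theory Submission
  imports Defs
begin

text \<open>Take \<open>u = \<pi> x v\<close> and \<open>w = 0\<close>. The derivative of \<open>\<Delta>\<^sub>i\<close> along this choice is continuous on the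
  compact set \<open>tilde_C D \<Delta>\<close> and nonnegative where \<open>\<Delta>\<^sub>i = 0\<close>, so for each \<open>e > 0\<close> it is at least
  \<open>- (e + L e * \<Delta>\<^sub>i)\<close> for some \<open>L e \<ge> 0\<close>. The infimum over \<open>e\<close> of the affine functions
  \<open>s \<mapsto> e + L e * s\<close> is concave, nondecreasing and vanishes continuously at 0; adding \<open>s\<close> makes it
  a class-\<open>K\<close> function, and the sum over \<open>i\<close> of these functions serves all components at once.\<close>

lemma locally_lipschitz_imp_continuous_on:
  assumes "locally_lipschitz h"
  shows "continuous_on S h"
proof -
  have "continuous (at x) h" for x
  proof -
    obtain e L where e: "e > 0" and "L-lipschitz_on (cball x e) h"
      using assms unfolding locally_lipschitz_def by blast
    then have "continuous_on (cball x e) h"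
      by (intro lipschitz_on_continuous_on)
    then show ?thesis
      using e by (intro continuous_on_interior[of "cball x e"] interiorI[of "ball x e"]) auto
  qed
  then show ?thesis
    by (simp add: continuous_at_imp_continuous_on)
qed

text \<open>The index set has to be nonempty because an empty sum is the zero function, which is not
  strictly increasing.\<close>

lemma class_K_sum:
  fixes \<alpha> :: "'i \<Rightarrow> real \<Rightarrow> real"
  assumes "finite I" "I \<noteq> {}" and K: "\<And>i. i \<in> I \<Longrightarrow> class_K (\<alpha> i)"
  shows "class_K (\<lambda>s. \<Sum>i\<in>I. \<alpha> i s)"
  unfolding class_K_def
proof (intro conjI)
  show "continuous_on {0..} (\<lambda>s. \<Sum>i\<in>I. \<alpha> i s)"
    using K by (intro continuous_on_sum) (simp add: class_K_def)
  show "strict_mono_on {0..} (\<lambda>s. \<Sum>i\<in>I. \<alpha> i s)"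
    using assms by (intro strict_mono_onI sum_strict_mono) (auto simp: class_K_def strict_mono_on_def)
  show "(\<Sum>i\<in>I. \<alpha> i 0) = 0"
    using K by (simp add: class_K_def)
  show "(\<lambda>s. \<Sum>i\<in>I. \<alpha> i s) ` {0..} \<subseteq> {0..}"
    using K by (auto simp: class_K_def image_subset_iff intro!: sum_nonneg)
qed

text \<open>Where \<open>h\<close> is at least \<open>e\<close> it is positive, so \<open>d\<close>
  cannot vanish there. That part of \<open>K\<close> is compact, hence \<open>d\<close> has a
  positive minimum and \<open>h\<close> a maximum on it, and their quotient serves as slope.
  Elsewhere the constant \<open>e\<close> alone suffices.\<close>

lemma affine_bound_on_compact:
  fixes h d :: "'a::topological_space \<Rightarrow> real"
  assumes "compact K" and h: "continuous_on K h" and d: "continuous_on K d"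
    and nonneg: "\<And>z. z \<in> K \<Longrightarrow> 0 \<le> d z"
    and zero: "\<And>z. z \<in> K \<Longrightarrow> d z = 0 \<Longrightarrow> h z \<le> 0"
    and "e > 0"
  shows "\<exists>L\<ge>0. \<forall>z\<in>K. h z \<le> e + L * d z"
proof -
  define A where "A = K \<inter> h -` {e..}"
  \<comment> \<open>The space need not be Hausdorff, so \<open>K\<close> need not be closed.
    Compactness of \<open>A\<close> is obtained by writing it as the intersection of
    \<open>K\<close> with a closed set.\<close>
  obtain F where F: "closed F" "F \<inter> K = h -` {e..} \<inter> K"
    using h closed_atLeast[of e] unfolding continuous_on_closed_invariant by blast
  then have "compact A"
    using compact_Int_closed[OF assms(1) F(1)] by (simp add: A_def Int_commute)
  show ?thesis
  proof (cases "A = {}")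
    case True
    then show ?thesis by (intro exI[of _ 0]) (force simp: A_def)
  next
    case False
    have "A \<subseteq> K" by (auto simp: A_def)
    obtain a where a: "a \<in> A" "\<And>z. z \<in> A \<Longrightarrow> d a \<le> d z"
      using continuous_attains_inf[OF \<open>compact A\<close> False continuous_on_subset[OF d \<open>A \<subseteq> K\<close>]] by blast
    obtain b where b: "b \<in> A" "\<And>z. z \<in> A \<Longrightarrow> h z \<le> h b"
      using continuous_attains_sup[OF \<open>compact A\<close> False continuous_on_subset[OF h \<open>A \<subseteq> K\<close>]] by blast
    have "d a > 0"
      using a(1) nonneg[of a] zero[of a] \<open>e > 0\<close> by (force simp: A_def)
    have "h b > 0"
      using b(1) \<open>e > 0\<close> by (simp add: A_def)
    have "h z \<le> e + h b / d a * d z" if "z \<in> K" for z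
    proof (cases "z \<in> A")
      case True
      have "h z \<le> h b / d a * d a"
        using b(2)[OF True] \<open>d a > 0\<close> by simp
      also have "\<dots> \<le> h b / d a * d z"
        using a(2)[OF True] \<open>d a > 0\<close> \<open>h b > 0\<close> by (intro mult_left_mono) auto
      finally show ?thesis using \<open>e > 0\<close> by simp
    next
      case False
      then have "h z \<le> e" using that by (simp add: A_def)
      moreover have "0 \<le> h b / d a * d z"
        using nonneg[OF that] \<open>d a > 0\<close> \<open>h b > 0\<close> by simp
      ultimately show ?thesis by linarith
    qed
    then show ?thesis
      using \<open>d a > 0\<close> \<open>h b > 0\<close> by (intro exI[of _ "h b / d a"]) auto
  qed
qed

text \<open>Continuity comes from concavity rather than from any regularity of \<open>L\<close>.
  Concavity yields it only on the open ray, since a concave function may jump at an endpoint; at 0 a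
  single well-chosen affine function squeezes the infimum.\<close>

lemma class_K_infimum_of_affine:
  fixes L :: "real \<Rightarrow> real"
  assumes L: "\<And>e. e > 0 \<Longrightarrow> L e \<ge> 0"
  shows "class_K (\<lambda>s. (INF e\<in>{0<..}. e + L e * s) + s)"
proof -
  define \<beta> where "\<beta> s = (INF e\<in>{0<..}. e + L e * s)" for s
  \<comment> \<open>For negative \<open>s\<close> the values may be unbounded below, which leaves
    the real infimum without meaning; hence the restriction of \<open>upper\<close> to
    \<open>s \<ge> 0\<close>. The bound \<open>greatest\<close> relies only on the index set being
    nonempty.\<close>
  have bdd: "bdd_below ((\<lambda>e. e + L e * s) ` {0<..})" if "s \<ge> 0" for s
    using that L by (intro bdd_belowI2[of _ 0]) simp
  have upper: "\<beta> s \<le> e + L e * s" if "s \<ge> 0" "e > 0" for s e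
    unfolding \<beta>_def using bdd that by (intro cINF_lower) auto
  have greatest: "c \<le> \<beta> s" if "\<And>e. e > 0 \<Longrightarrow> c \<le> e + L e * s" for c s
    unfolding \<beta>_def using that by (intro cINF_greatest) auto
  have \<beta>_nonneg: "0 \<le> \<beta> s" if "s \<ge> 0" for s
    using that L by (intro greatest) simp
  have \<beta>_mono: "\<beta> s \<le> \<beta> t" if "0 \<le> s" "s \<le> t" for s t
  proof (rule greatest)
    fix e :: real assume "e > 0"
    then have "L e * s \<le> L e * t"
      using L that by (intro mult_left_mono) auto
    then show "\<beta> s \<le> e + L e * t"
      using upper[OF that(1) \<open>e > 0\<close>] by linarith
  qed
  have \<beta>_0: "\<beta> 0 = 0"
  proof (rule antisym)
    show "\<beta> 0 \<le> 0"
      by (rule field_le_epsilon) (use upper[of 0] in simp)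
  qed (simp add: \<beta>_nonneg)
  have "concave_on {0<..} \<beta>"
    unfolding concave_on_iff
  proof (intro conjI ballI allI impI)
    fix x y u v :: real
    assume xy: "x \<in> {0<..}" "y \<in> {0<..}" and uv: "0 \<le> u" "0 \<le> v" "u + v = 1"
    \<comment> \<open>The same \<open>e\<close> is used at both points, and the weights sum to 1, so
      the two affine bounds recombine into the one at the convex combination.\<close>
    have "u * \<beta> x + v * \<beta> y \<le> e + L e * (u * x + v * y)" if "e > 0" for e
    proof -
      have "u * \<beta> x + v * \<beta> y \<le> u * (e + L e * x) + v * (e + L e * y)"
        using xy uv that upper by (intro add_mono mult_left_mono) auto
      also have "\<dots> = (u + v) * e + L e * (u * x + v * y)"
        by (simp add: algebra_simps)
      finally show ?thesis using uv by simp
    qed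
    then show "u * \<beta> x + v * \<beta> y \<le> \<beta> (u *\<^sub>R x + v *\<^sub>R y)"
      by (intro greatest) simp
  qed auto
  then have cont_pos: "continuous_on {0<..} \<beta>"
    using continuous_on_minus[OF convex_on_continuous[of "{0<..}" "\<lambda>s. - \<beta> s"]]
    by (simp add: concave_on_def)
  have "continuous (at s within {0..}) \<beta>" if "s \<ge> 0" for s
  proof (cases "s = 0")
    case False
    then have "continuous (at s) \<beta>"
      using cont_pos that by (simp add: continuous_on_eq_continuous_at)
    then show ?thesis by (rule continuous_at_imp_continuous_at_within)
  next
    case True
    have "\<exists>r>0. \<forall>t\<in>{0..}. dist t 0 < r \<longrightarrow> dist (\<beta> t) (\<beta> 0) < \<epsilon>" if "\<epsilon> > 0" for \<epsilon>
    \<comment> \<open>Half of \<epsilon> is spent on the intercept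
      \<open>e = \<epsilon> / 2\<close>, and the radius keeps the slope term below the other half.
      The \<open>+ 1\<close> keeps the divisor positive when the slope is 0.\<close>
    proof (intro exI[of _ "\<epsilon> / 2 / (L (\<epsilon> / 2) + 1)"] conjI ballI impI)
      have L2: "0 \<le> L (\<epsilon> / 2)" using L that by simp
      then show "0 < \<epsilon> / 2 / (L (\<epsilon> / 2) + 1)" using that by simp
      fix t :: real assume t: "t \<in> {0..}" "dist t 0 < \<epsilon> / 2 / (L (\<epsilon> / 2) + 1)"
      then have "t < \<epsilon> / 2 / (L (\<epsilon> / 2) + 1)" by simp
      then have "t * (L (\<epsilon> / 2) + 1) < \<epsilon> / 2"
        by (rule pos_less_divide_eq[THEN iffD1, rotated]) (use L2 in linarith)
      then have "L (\<epsilon> / 2) * t < \<epsilon> / 2"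
        using t by (simp add: distrib_left mult.commute)
      then have "\<beta> t < \<epsilon>"
        using upper[of t "\<epsilon> / 2"] t that by simp
      then show "dist (\<beta> t) (\<beta> 0) < \<epsilon>"
        using \<beta>_nonneg[of t] t by (simp add: \<beta>_0)
    qed
    then show ?thesis
      unfolding True continuous_within_eps_delta by blast
  qed
  then have cont: "continuous_on {0..} \<beta>"
    by (simp add: continuous_on_eq_continuous_within)
  have "class_K (\<lambda>s. \<beta> s + s)"
    unfolding class_K_def
  proof (intro conjI)
    show "continuous_on {0..} (\<lambda>s. \<beta> s + s)"
      by (intro continuous_intros cont)
    show "strict_mono_on {0..} (\<lambda>s. \<beta> s + s)"
      by (intro strict_mono_onI add_le_less_mono \<beta>_mono) auto
    show "\<beta> 0 + 0 = 0" by (simp add: \<beta>_0)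
    show "(\<lambda>s. \<beta> s + s) ` {0..} \<subseteq> {0..}"
      by (intro image_subsetI) (simp add: \<beta>_nonneg)
  qed
  then show ?thesis by (simp add: \<beta>_def)
qed

text \<open>The affine bounds hold for every \<open>e\<close> at once, so \<open>h z\<close> is a
  lower bound of all of them and stays below their infimum; the extra summand \<open>d z\<close> is
  nonnegative.\<close>

lemma class_K_dominates_on_compact:
  fixes h d :: "'a::topological_space \<Rightarrow> real"
  assumes "compact K" "continuous_on K h" "continuous_on K d"
    and nonneg: "\<And>z. z \<in> K \<Longrightarrow> 0 \<le> d z"
    and "\<And>z. z \<in> K \<Longrightarrow> d z = 0 \<Longrightarrow> h z \<le> 0"
  shows "\<exists>\<alpha>. class_K \<alpha> \<and> (\<forall>z\<in>K. h z \<le> \<alpha> (d z))"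
proof -
  have "\<forall>e>0. \<exists>L\<ge>0. \<forall>z\<in>K. h z \<le> e + L * d z"
    using affine_bound_on_compact[OF assms] by blast
  then obtain L where L: "\<And>e. e > 0 \<Longrightarrow> 0 \<le> L e"
    and bound: "\<And>e z. e > 0 \<Longrightarrow> z \<in> K \<Longrightarrow> h z \<le> e + L e * d z"
    by metis
  have "h z \<le> (INF e\<in>{0<..}. e + L e * d z) + d z" if "z \<in> K" for z
  proof -
    have "h z \<le> (INF e\<in>{0<..}. e + L e * d z)"
      using bound that by (intro cINF_greatest) auto
    then show ?thesis using nonneg[OF that] by linarith
  qed
  then show ?thesis
    using class_K_infimum_of_affine[of L] L by blast
qed

text \<open>The boundary condition of a safety margin speaks of the derivative of a slice, whereas
  continuity is available for the full derivative. The chain rule along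
  \<open>y \<mapsto> (y, v)\<close> links the two.\<close>

lemma partial_x_eq:
  assumes "(\<Delta> has_derivative \<Delta>') (at (x, v))"
  shows "partial_x \<Delta> i x v y = \<Delta>' (y, 0) $ i"
proof -
  have "((\<lambda>y. (y, v)) has_derivative (\<lambda>y. (y, 0))) (at x)"
    by (auto intro!: derivative_eq_intros)
  then have "((\<lambda>y. \<Delta> (y, v)) has_derivative (\<lambda>y. \<Delta>' (y, 0))) (at x)"
    using has_derivative_compose assms by blast
  then have "((\<lambda>y. \<Delta> (y, v) $ i) has_derivative (\<lambda>y. \<Delta>' (y, 0) $ i)) (at x)"
    by (rule bounded_linear.has_derivative[OF bounded_linear_vec_nth])
  then show ?thesis
    unfolding partial_x_def by (simp flip: frechet_derivative_at)
qed

text \<open>\<open>frechet_derivative\<close> is a choice operator, so its linearity, and with it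
  the value at 0, is available only once the slice is known to be differentiable.\<close>

lemma partial_v_zero:
  assumes "(\<Delta> has_derivative \<Delta>') (at (x, v))"
  shows "partial_v \<Delta> i x v 0 = 0"
proof -
  have "((\<lambda>y. (x, y)) has_derivative (\<lambda>y. (0, y))) (at v)"
    by (auto intro!: derivative_eq_intros)
  then have "((\<lambda>y. \<Delta> (x, y)) has_derivative (\<lambda>y. \<Delta>' (0, y))) (at v)"
    using has_derivative_compose assms by blast
  then have "((\<lambda>y. \<Delta> (x, y) $ i) has_derivative (\<lambda>y. \<Delta>' (0, y) $ i)) (at v)"
    by (rule bounded_linear.has_derivative[OF bounded_linear_vec_nth])
  then have "(\<lambda>y. \<Delta> (x, y) $ i) differentiable (at v)"
    by (rule differentiableI)
  then show ?thesis
    unfolding partial_v_def by (intro linear_0 linear_frechet_derivative)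
qed

lemma continuous_on_matrix_vector_mult:
  fixes A :: "'a::topological_space \<Rightarrow> real^'m^'n" and b :: "'a \<Rightarrow> real^'m"
  assumes "continuous_on S A" "continuous_on S b"
  shows "continuous_on S (\<lambda>z. A z *v b z)"
  unfolding matrix_vector_mult_def
  by (intro continuous_intros assms)

theorem theorem4:
  fixes f :: "real^'n \<Rightarrow> real^'n"
    and g :: "real^'n \<Rightarrow> real^'m^'n"
    and X :: "(real^'n) set"
    and U :: "(real^'m) set"
    and xbar :: "real^'l \<Rightarrow> real^'n"
    and ubar :: "real^'l \<Rightarrow> real^'m"
    and \<pi> :: "real^'n \<Rightarrow> real^'l \<Rightarrow> real^'m"
    and D :: "real^'l \<Rightarrow> (real^'n) set"
    and \<Delta> :: "(real^'n) \<times> (real^'l) \<Rightarrow> real^'c"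
  assumes "locally_lipschitz f"
    and "locally_lipschitz g"
    and "closed X"
    and "closed U"
    and "equilibrium_manifold f g xbar ubar"
    and "admissible_references X U xbar ubar \<noteq> {}"
    and "prestabilizing f g xbar ubar \<pi>"
    and "attraction_domains f g xbar \<pi> D"
    and "dynamic_safety_margin f g X U xbar ubar \<pi> D \<Delta>"
  shows "augmented_control_barrier_function f g U D \<Delta>"
proof -
  define C where "C = tilde_C D \<Delta>"
  define F where "F z = closed_loop f g \<pi> (fst z) (snd z)" for z
  have C_sub: "C \<subseteq> tilde_D D" and \<Delta>_nonneg: "\<And>z i. z \<in> C \<Longrightarrow> 0 \<le> \<Delta> z $ i"
    by (auto simp: C_def tilde_C_def)
  have "compact C" and C_admissible: "C \<subseteq> tilde_X X U xbar ubar \<pi>"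
    and boundary: "\<And>i x v. (x, v) \<in> tilde_D D \<Longrightarrow> \<Delta> (x, v) $ i = 0 \<Longrightarrow>
      0 \<le> partial_x \<Delta> i x v (closed_loop f g \<pi> x v)"
    using assms(9) unfolding dynamic_safety_margin_def C_def by auto
  obtain \<Delta>' where \<Delta>': "\<And>z. z \<in> tilde_D D \<Longrightarrow> (\<Delta> has_derivative blinfun_apply (\<Delta>' z)) (at z)"
    and \<Delta>'_cont: "continuous_on (tilde_D D) \<Delta>'"
    using assms(9) unfolding dynamic_safety_margin_def continuously_differentiable_on_def by blast
  have "continuous_on UNIV (\<lambda>z. \<pi> (fst z) (snd z))"
    using assms(7) by (simp add: prestabilizing_def case_prod_unfold)
  then have "continuous_on C (\<lambda>z. \<pi> (fst z) (snd z))"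
    by (rule continuous_on_subset) simp
  moreover have "continuous_on C (\<lambda>z. f (fst z))" "continuous_on C (\<lambda>z. g (fst z))"
    using assms(1,2)[THEN locally_lipschitz_imp_continuous_on]
    by (simp_all add: continuous_on_compose2[of UNIV _ C fst] continuous_on_fst)
  ultimately have F_cont: "continuous_on C F"
    unfolding F_def closed_loop_def
    by (intro continuous_on_add continuous_on_matrix_vector_mult)
  have along: "partial_x \<Delta> i x v (closed_loop f g \<pi> x v) = \<Delta>' (x, v) (F (x, v), 0) $ i"
    if "(x, v) \<in> tilde_D D" for i x v
    using partial_x_eq[OF \<Delta>'[OF that]] by (simp add: F_def)
  \<comment> \<open>Here \<open>h\<close> is the rate of decrease of the component along the
    prestabilized flow with \<open>v\<close> frozen, and \<open>d\<close> is the component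
    itself.\<close>
  have "\<exists>\<alpha>. class_K \<alpha> \<and> (\<forall>z\<in>C. - (\<Delta>' z (F z, 0) $ i) \<le> \<alpha> (\<Delta> z $ i))" for i
  proof (rule class_K_dominates_on_compact[OF \<open>compact C\<close>])
    show "continuous_on C (\<lambda>z. - (\<Delta>' z (F z, 0) $ i))"
      \<comment> \<open>\<open>\<Delta>'\<close> is continuous in operator norm, so it may be
        applied to a direction that varies continuously with \<open>z\<close>.\<close>
      by (intro continuous_intros F_cont continuous_on_subset[OF \<Delta>'_cont C_sub])
    show "continuous_on C (\<lambda>z. \<Delta> z $ i)"
      using C_sub has_derivative_continuous[OF \<Delta>']
      by (intro continuous_intros continuous_at_imp_continuous_on) blast
    show "- (\<Delta>' z (F z, 0) $ i) \<le> 0" if z: "z \<in> C" "\<Delta> z $ i = 0" for z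
    proof -
      obtain x v where "z = (x, v)" by (cases z)
      then show ?thesis
        using z subsetD[OF C_sub z(1)] boundary[of x v i] along[of x v i] by simp
    qed
  qed (rule \<Delta>_nonneg)
  then obtain \<alpha> where K: "\<And>i. class_K (\<alpha> i)"
    and dom: "\<And>i z. z \<in> C \<Longrightarrow> - (\<Delta>' z (F z, 0) $ i) \<le> \<alpha> i (\<Delta> z $ i)"
    by metis
  define A where "A s = (\<Sum>i\<in>UNIV. \<alpha> i s)" for s
  have "class_K A"
    unfolding A_def using K by (intro class_K_sum) auto
  moreover have "\<pi> x v \<in> U \<and> (MIN i. Delta_dot f g \<Delta> i x v (\<pi> x v) 0 + A (\<Delta> (x, v) $ i)) \<ge> 0"
    if z: "(x, v) \<in> C" for x v
  proof
    \<comment> \<open>The inclusion of the safe set in the constraint set is what makes the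
      prestabilizing input admissible.\<close>
    show "\<pi> x v \<in> U"
      using z C_admissible by (auto simp: tilde_X_def constraint_slice_def)
    have "0 \<le> Delta_dot f g \<Delta> i x v (\<pi> x v) 0 + A (\<Delta> (x, v) $ i)" for i
    proof -
      have D: "(x, v) \<in> tilde_D D" using z C_sub by blast
      \<comment> \<open>Every \<open>\<alpha> j\<close> is evaluated at the value of component
        \<open>i\<close>, not \<open>j\<close>: the sum \<open>A\<close> takes one argument, and its
        other summands are nonnegative there, so it dominates \<open>\<alpha> i\<close>.\<close>
      have "\<alpha> j (\<Delta> (x, v) $ i) \<ge> 0" for j
        using K[of j] \<Delta>_nonneg[OF z] by (auto simp: class_K_def)
      then have "\<alpha> i (\<Delta> (x, v) $ i) \<le> A (\<Delta> (x, v) $ i)"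
        unfolding A_def by (intro member_le_sum) auto
      then show ?thesis
        using dom[OF z, of i] along[OF D, of i] partial_v_zero[OF \<Delta>'[OF D], of i]
        by (simp add: Delta_dot_def closed_loop_def)
    qed
    then show "(MIN i. Delta_dot f g \<Delta> i x v (\<pi> x v) 0 + A (\<Delta> (x, v) $ i)) \<ge> 0"
      by (subst Min_ge_iff) auto
  qed
  ultimately show ?thesis
    unfolding augmented_control_barrier_function_def C_def[symmetric]
    by (intro exI[of _ A]) fastforce
qed

end
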